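(* Approximation by closed geodesics does not imply recurrence: there exist $\chi<0$, a locally compact, complete, geodesic metric space $X$ which has curvature less than or equal to $\chi$, and a geodesic $\gamma:\mathbb{R}\to X$ such that $\gamma$ is approximated by closed geodesics but $\gamma$ is not recurrent.
   Context: All curves are parametrized by arclength; $d$ denotes the metric of $X$. A geodesic metric space $X$ has curvature less than or equal to $\chi$ ($\chi<0$) if each $x\in X$ has a neighborhood $V_x$ such that every geodesic triangle contained in $V_x$ satisfies the $CAT(\chi)$ comparison inequality. A geodesic segment is an isometric embedding of a closed interval into $X$. A local geodesic is a map $c:I\to X$ from an interval $I\subseteq\mathbb{R}$ such that for each $t\in I$ there is $\varepsilon>0$ for which $c|_{[t-\varepsilon,t+\varepsilon]\cap I}$ is a geodesic segment. In this statement a "geodesic in $X$" is a local geodesic $\mathbb{R}\to X$ (oriented by its parametrization). A closed geodesic is a local geodesic $c:\mathbb{R}\to X$ which is a periodic map, with period $\mathrm{period}(c)>0$. For $t\in\mathbb{R}$, $t\gamma$ is defined by $(t\gamma)(s)=\gamma(s+t)$. A geodesic $\gamma$ is recurrent if there is a sequence of real numbers $t_n\to+\infty$ such that $t_n\gamma\to\gamma$ uniformly on compact subsets of $\mathbb{R}$. A geodesic $\gamma$ is approximated by closed geodesics if for every $\varepsilon>0$ and every $x\in\mathrm{Im}\,\gamma$ there exists a closed oriented geodesic $c$ such that for some point $y\in\mathrm{Im}\,c$, $$d\big(c(t+t_y),\gamma(t+t_x)\big)<\varepsilon\quad\text{for all } t\in[0,\mathrm{period}(c)],$$ where $t_x,t_y\in\mathbb{R}$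 are such that $x=\gamma(t_x)$ and $y=c(t_y)$. *)

theory Defs
  imports "HOL-Analysis.Analysis"
begin

text \<open>An existence statement cannot quantify over types, so spaces are carriers \<open>M\<close> with an
  arbitrary metric \<open>d\<close>. Taking \<open>M :: real set\<close> loses nothing: a locally compact, complete,
  geodesic space is proper, hence separable, hence has at most continuum many points.\<close>

section \<open>Geodesics in a metric space with carrier M and distance d\<close>

definition isometric_embedding_on ::
    "'a set \<Rightarrow> ('a \<Rightarrow> 'a \<Rightarrow> real) \<Rightarrow> real set \<Rightarrow> (real \<Rightarrow> 'a) \<Rightarrow> bool" where
  "isometric_embedding_on M d I c \<longleftrightarrow>
     c ` I \<subseteq> M \<and> (\<forall>s\<in>I. \<forall>t\<in>I. d (c s) (c t) = \<bar>s - t\<bar>)"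

definition geodesic_segment_joining ::
    "'a set \<Rightarrow> ('a \<Rightarrow> 'a \<Rightarrow> real) \<Rightarrow> (real \<Rightarrow> 'a) \<Rightarrow> 'a \<Rightarrow> 'a \<Rightarrow> bool" where
  "geodesic_segment_joining M d c p q \<longleftrightarrow>
     isometric_embedding_on M d {0..d p q} c \<and> c 0 = p \<and> c (d p q) = q"

definition geodesic_space :: "'a set \<Rightarrow> ('a \<Rightarrow> 'a \<Rightarrow> real) \<Rightarrow> bool" where
  "geodesic_space M d \<longleftrightarrow> (\<forall>p\<in>M. \<forall>q\<in>M. \<exists>c. geodesic_segment_joining M d c p q)"

definition local_geodesic_on ::
    "'a set \<Rightarrow> ('a \<Rightarrow> 'a \<Rightarrow> real) \<Rightarrow> real set \<Rightarrow> (real \<Rightarrow> 'a) \<Rightarrow> bool" where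
  "local_geodesic_on M d I c \<longleftrightarrow>
     is_interval I \<and>
     (\<forall>t\<in>I. \<exists>\<epsilon>>0. isometric_embedding_on M d ({t - \<epsilon>..t + \<epsilon>} \<inter> I) c)"

abbreviation geodesic_line :: "'a set \<Rightarrow> ('a \<Rightarrow> 'a \<Rightarrow> real) \<Rightarrow> (real \<Rightarrow> 'a) \<Rightarrow> bool" where
  "geodesic_line M d \<equiv> local_geodesic_on M d UNIV"


section \<open>Curvature bounded above by a negative constant\<close>

text \<open>The model plane of constant curvature \<open>\<kappa> < 0\<close> (the bound is called
  \<open>\<kappa>\<close> because the library reserves the letter chi as a binder): the upper sheet of the hyperboloid,
  whose hyperbolic distance is determined by \<open>cosh (d u v) = - lorentz_form u v\<close>, rescaled by
  \<open>1 / sqrt (- \<kappa>)\<close>.\<close>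

definition lorentz_form :: "real \<times> real \<times> real \<Rightarrow> real \<times> real \<times> real \<Rightarrow> real" where
  "lorentz_form = (\<lambda>(x1, x2, x3) (y1, y2, y3). x1 * y1 + x2 * y2 - x3 * y3)"

definition hyperboloid :: "(real \<times> real \<times> real) set" where
  "hyperboloid = {u. lorentz_form u u = - 1 \<and> snd (snd u) > 0}"

definition model_dist :: "real \<Rightarrow> real \<times> real \<times> real \<Rightarrow> real \<times> real \<times> real \<Rightarrow> real" where
  "model_dist \<kappa> u v = arcosh (- lorentz_form u v) / sqrt (- \<kappa>)"

text \<open>A geodesic triangle consists of three vertices and a choice of three sides.\<close>

definition geodesic_triangle ::
    "'a set \<Rightarrow> ('a \<Rightarrow> 'a \<Rightarrow> real) \<Rightarrow> 'a \<Rightarrow> 'a \<Rightarrow> 'a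
      \<Rightarrow> (real \<Rightarrow> 'a) \<Rightarrow> (real \<Rightarrow> 'a) \<Rightarrow> (real \<Rightarrow> 'a) \<Rightarrow> bool" where
  "geodesic_triangle M d p q r a b c \<longleftrightarrow>
     p \<in> M \<and> q \<in> M \<and> r \<in> M \<and>
     geodesic_segment_joining M d a p q \<and>
     geodesic_segment_joining M d b q r \<and>
     geodesic_segment_joining M d c r p"

text \<open>The comparison triangle exists and is unique up to isometry of the model plane when
  \<open>\<kappa> < 0\<close>, so quantifying universally over comparison triangles is harmless. The comparison
  point of a point at parameter \<open>s\<close> on a side is the point at parameter \<open>s\<close> on the
  corresponding comparison side.\<close>

definition CAT_inequality ::
    "real \<Rightarrow> ('a \<Rightarrow> 'a \<Rightarrow> real) \<Rightarrow> 'a \<Rightarrow> 'a \<Rightarrow> 'a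
      \<Rightarrow> (real \<Rightarrow> 'a) \<Rightarrow> (real \<Rightarrow> 'a) \<Rightarrow> (real \<Rightarrow> 'a) \<Rightarrow> bool" where
  "CAT_inequality \<kappa> d p q r a b c \<longleftrightarrow>
     (\<forall>p' q' r' a' b' c'.
        geodesic_triangle hyperboloid (model_dist \<kappa>) p' q' r' a' b' c' \<longrightarrow>
        model_dist \<kappa> p' q' = d p q \<longrightarrow>
        model_dist \<kappa> q' r' = d q r \<longrightarrow>
        model_dist \<kappa> r' p' = d r p \<longrightarrow>
        (\<forall>(e, e', l) \<in> {(a, a', d p q), (b, b', d q r), (c, c', d r p)}.
         \<forall>(f, f', m) \<in> {(a, a', d p q), (b, b', d q r), (c, c', d r p)}.
         \<forall>s\<in>{0..l}. \<forall>t\<in>{0..m}. d (e s) (f t) \<le> model_dist \<kappa> (e' s) (f' t)))"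

definition curvature_le :: "'a set \<Rightarrow> ('a \<Rightarrow> 'a \<Rightarrow> real) \<Rightarrow> real \<Rightarrow> bool" where
  "curvature_le M d \<kappa> \<longleftrightarrow>
     (\<forall>x\<in>M. \<exists>V U. openin (Metric_space.mtopology M d) U \<and> x \<in> U \<and> U \<subseteq> V \<and> V \<subseteq> M \<and>
        (\<forall>p q r a b c.
           geodesic_triangle M d p q r a b c \<longrightarrow>
           a ` {0..d p q} \<union> b ` {0..d q r} \<union> c ` {0..d r p} \<subseteq> V \<longrightarrow>
           CAT_inequality \<kappa> d p q r a b c))"


section \<open>Closed geodesics, recurrence and approximation\<close>

definition closed_geodesic :: "'a set \<Rightarrow> ('a \<Rightarrow> 'a \<Rightarrow> real) \<Rightarrow> (real \<Rightarrow> 'a) \<Rightarrow> bool" where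
  "closed_geodesic M d c \<longleftrightarrow> geodesic_line M d c \<and> (\<exists>p>0. \<forall>t. c (t + p) = c t)"

text \<open>The least positive period; for a closed geodesic the infimum is positive and attained,
  since a local geodesic is continuous and locally injective.\<close>

definition period :: "(real \<Rightarrow> 'a) \<Rightarrow> real" where
  "period c = Inf {p. p > 0 \<and> (\<forall>t. c (t + p) = c t)}"

definition geodesic_shift :: "real \<Rightarrow> (real \<Rightarrow> 'a) \<Rightarrow> real \<Rightarrow> 'a" where
  "geodesic_shift t \<gamma> = (\<lambda>s. \<gamma> (s + t))"

definition recurrent :: "('a \<Rightarrow> 'a \<Rightarrow> real) \<Rightarrow> (real \<Rightarrow> 'a) \<Rightarrow> bool" where
  "recurrent d \<gamma> \<longleftrightarrow>
     (\<exists>t :: nat \<Rightarrow> real. filterlim t at_top sequentially \<and>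
        (\<forall>K. compact K \<longrightarrow>
           (\<forall>\<epsilon>>0. \<forall>\<^sub>F n in sequentially. \<forall>s\<in>K. d (geodesic_shift (t n) \<gamma> s) (\<gamma> s) < \<epsilon>)))"

text \<open>A point of the image of \<open>\<gamma>\<close> may be attained at several parameters \<open>tx\<close>; the condition is
  required for each of them.\<close>

definition approximated_by_closed_geodesics ::
    "'a set \<Rightarrow> ('a \<Rightarrow> 'a \<Rightarrow> real) \<Rightarrow> (real \<Rightarrow> 'a) \<Rightarrow> bool" where
  "approximated_by_closed_geodesics M d \<gamma> \<longleftrightarrow>
     (\<forall>\<epsilon>>0. \<forall>x\<in>range \<gamma>. \<forall>tx. x = \<gamma> tx \<longrightarrow>
        (\<exists>c. closed_geodesic M d c \<and>
           (\<exists>y\<in>range c. \<exists>ty. y = c ty \<and>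
              (\<forall>t\<in>{0..period c}. d (c (t + ty)) (\<gamma> (t + tx)) < \<epsilon>))))"

end

theory Submission
  imports Defs
begin

text \<open>\<open>X\<close> is the figure eight: two circles \<open>a\<close>, \<open>b\<close> of length 1 glued at a point. A bi-infinite
  word in \<open>a\<close>, \<open>b\<close> (no inverses) spells a local geodesic, and \<open>\<gamma>\<close> spells
  \<open>\<dots>aaa.abababab\<dots>\<close>. Every letter of this word reappears to its right, and
  closing up the word in between yields a closed geodesic that agrees with \<open>\<gamma>\<close> over one period.
  But \<open>aa\<close> does not occur far to the right, so \<open>\<gamma>\<close> is not recurrent. Small balls of \<open>X\<close>
  are trees, where the four-point condition reduces the comparison inequality for every curvature
  bound to the triangle inequality in the model plane.\<close>

section \<open>The triangle inequality in the model plane\<close>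

lemma lorentz_form_commute: "lorentz_form u v = lorentz_form v u"
  by (auto simp: lorentz_form_def split: prod.splits)

text \<open>Cauchy-Schwarz for \<open>(x1, x2, 1)\<close> and \<open>(y1, y2, 1)\<close>, whose
  norms are the third coordinates \<open>x3\<close> and \<open>y3\<close>. It puts the argument of
  \<open>arcosh\<close> in \<open>model_dist\<close> into the range from 1 upwards.\<close>

lemma lorentz_form_le_neg1:
  assumes "u \<in> hyperboloid" "v \<in> hyperboloid"
  shows "lorentz_form u v \<le> - 1"
proof -
  obtain x1 x2 x3 where u: "u = (x1, x2, x3)" by (cases u) auto
  obtain y1 y2 y3 where v: "v = (y1, y2, y3)" by (cases v) auto
  have x: "x1\<^sup>2 + x2\<^sup>2 + 1 = x3\<^sup>2" "x3 > 0" and y: "y1\<^sup>2 + y2\<^sup>2 + 1 = y3\<^sup>2" "y3 > 0"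
    using assms by (auto simp: u v hyperboloid_def lorentz_form_def power2_eq_square)
  have "(x1 * y1 + x2 * y2 + 1)\<^sup>2 \<le> (x1\<^sup>2 + x2\<^sup>2 + 1) * (y1\<^sup>2 + y2\<^sup>2 + 1)"
  proof -
    have "(x1\<^sup>2 + x2\<^sup>2 + 1) * (y1\<^sup>2 + y2\<^sup>2 + 1) - (x1 * y1 + x2 * y2 + 1)\<^sup>2
        = (x1 * y2 - x2 * y1)\<^sup>2 + (x1 - y1)\<^sup>2 + (x2 - y2)\<^sup>2"
      by (simp add: power2_eq_square algebra_simps)
    then show ?thesis
      by (smt (verit) zero_le_power2)
  qed
  then have "(x1 * y1 + x2 * y2 + 1)\<^sup>2 \<le> (x3 * y3)\<^sup>2"
    by (simp add: x y power_mult_distrib)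
  then have "x1 * y1 + x2 * y2 + 1 \<le> x3 * y3"
    by (rule power2_le_imp_le) (simp add: x(2) y(2) less_imp_le)
  then show ?thesis
    by (simp add: u v lorentz_form_def)
qed

text \<open>The Gram matrix of \<open>u, v, w\<close> has determinant \<open>- (det (u, v, w))\<^sup>2 \<le> 0\<close>.\<close>

lemma lorentz_gram:
  assumes "u \<in> hyperboloid" "v \<in> hyperboloid" "w \<in> hyperboloid"
  shows "(- lorentz_form u w - lorentz_form u v * lorentz_form v w)\<^sup>2
    \<le> ((lorentz_form u v)\<^sup>2 - 1) * ((lorentz_form v w)\<^sup>2 - 1)"
proof -
  obtain x1 x2 x3 where u: "u = (x1, x2, x3)" by (cases u) auto
  obtain y1 y2 y3 where v: "v = (y1, y2, y3)" by (cases v) auto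
  obtain z1 z2 z3 where w: "w = (z1, z2, z3)" by (cases w) auto
  define D where "D = x1 * (y2 * z3 - y3 * z2) - x2 * (y1 * z3 - y3 * z1) + x3 * (y1 * z2 - y2 * z1)"
  define A B C where "A = lorentz_form u u" and "B = lorentz_form v v" and "C = lorentz_form w w"
  define a b c where "a = lorentz_form u v" and "b = lorentz_form v w" and "c = lorentz_form u w"
  have "A * B * C + 2 * a * b * c - A * b\<^sup>2 - B * c\<^sup>2 - C * a\<^sup>2 = - D\<^sup>2"
    unfolding A_def B_def C_def a_def b_def c_def D_def
    unfolding u v w lorentz_form_def prod.case by algebra
  moreover have "A = -1" "B = -1" "C = -1"
    using assms by (auto simp: A_def B_def C_def hyperboloid_def)
  ultimately have "(a\<^sup>2 - 1) * (b\<^sup>2 - 1) - (- c - a * b)\<^sup>2 = D\<^sup>2"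
    by (simp add: power2_eq_square algebra_simps)
  then show ?thesis
    unfolding a_def b_def c_def by (smt (verit) zero_le_power2)
qed

lemma model_dist_commute: "model_dist \<kappa> u v = model_dist \<kappa> v u"
  by (simp add: model_dist_def lorentz_form_commute)

text \<open>The Gram inequality bounds \<open>c\<close> by
  \<open>a * b + sqrt (a\<^sup>2 - 1) * sqrt (b\<^sup>2 - 1)\<close>, which the addition theorem
  identifies as \<open>cosh (arcosh a + arcosh b)\<close>.\<close>

lemma model_dist_triangle:
  assumes "\<kappa> < 0" "u \<in> hyperboloid" "v \<in> hyperboloid" "w \<in> hyperboloid"
  shows "model_dist \<kappa> u w \<le> model_dist \<kappa> u v + model_dist \<kappa> v w"
proof -
  define a b c where "a = - lorentz_form u v" and "b = - lorentz_form v w" and "c = - lorentz_form u w"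
  have 1: "a \<ge> 1" "b \<ge> 1" "c \<ge> 1"
    using lorentz_form_le_neg1[OF assms(2,3)] lorentz_form_le_neg1[OF assms(3,4)]
      lorentz_form_le_neg1[OF assms(2,4)] by (simp_all add: a_def b_def c_def)
  have "(c - a * b)\<^sup>2 \<le> (a\<^sup>2 - 1) * (b\<^sup>2 - 1)"
    using lorentz_gram[OF assms(2-4)] by (simp add: a_def b_def c_def)
  then have "c - a * b \<le> sqrt (a\<^sup>2 - 1) * sqrt (b\<^sup>2 - 1)"
    by (metis real_le_rsqrt real_sqrt_mult)
  then have "c \<le> cosh (arcosh a + arcosh b)"
    using 1 by (simp add: cosh_add cosh_arcosh_real sinh_arcosh_real)
  then have "arcosh c \<le> arcosh (cosh (arcosh a + arcosh b))"
    using 1 by (metis arcosh_less_iff_real cosh_real_ge_1 not_less)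
  also have "\<dots> = arcosh a + arcosh b"
    using 1 by (intro arcosh_cosh_real add_nonneg_nonneg arcosh_nonneg_real)
  finally show ?thesis
    using assms(1) by (simp add: model_dist_def a_def b_def c_def flip: add_divide_distrib)
      (simp add: divide_right_mono)
qed

section \<open>The four-point condition implies the comparison inequality\<close>

text \<open>Gromov's 0-hyperbolicity; for metrics it characterizes the subspaces of real
  trees.\<close>

definition four_point_on :: "'a set \<Rightarrow> ('a \<Rightarrow> 'a \<Rightarrow> real) \<Rightarrow> bool" where
  "four_point_on V d \<longleftrightarrow> (\<forall>x\<in>V. \<forall>y\<in>V. \<forall>z\<in>V. \<forall>w\<in>V.
     d x y + d z w \<le> max (d x z + d y w) (d x w + d y z))"

text \<open>In terms of Gromov products at \<open>p\<close>, the four-point condition gives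
  \<open>(x|y) \<ge> min (d p x) (min (q|r) (d p y))\<close>; both resulting upper bounds for \<open>d x y\<close> are lower
  bounds for \<open>D x' y'\<close> by the triangle inequality.\<close>

lemma four_point_comparison:
  assumes d: "four_point_on V d" "\<And>u v. u \<in> V \<Longrightarrow> v \<in> V \<Longrightarrow> d u v = d v u"
    and V: "p \<in> V" "q \<in> V" "r \<in> V" "x \<in> V" "y \<in> V"
    and D: "\<And>u v. D u v = D v u" "\<And>u v w. u \<in> H \<Longrightarrow> v \<in> H \<Longrightarrow> w \<in> H \<Longrightarrow> D u w \<le> D u v + D v w"
    and H: "p' \<in> H" "q' \<in> H" "r' \<in> H" "x' \<in> H" "y' \<in> H"
    and x: "d p x + d x q = d p q" "D p' x' = d p x" "D x' q' = d x q"
    and y: "d p y + d y r = d p r" "D p' y' = d p y" "D y' r' = d y r"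
    and qr: "D q' r' = d q r"
  shows "d x y \<le> D x' y'"
proof -
  \<comment> \<open>The term \<open>d y q\<close> in the first instance has no known counterpart in
    the model plane; the second instance eliminates it. The bounds left for \<open>d x y\<close> are
    \<bar>\<open>d p x - d p y\<close>\<bar> and \<open>d q r - d x q - d y r\<close>.\<close>
  have 1: "d x y + d p q \<le> max (d x p + d y q) (d x q + d y p)"
    and 2: "d y q + d p r \<le> max (d y p + d q r) (d y r + d q p)"
    using d(1) V unfolding four_point_on_def by blast+
  have s: "d x p = d p x" "d y p = d p y" "d q p = d p q"
    using d(2) V by auto
  have "D p' x' \<le> D p' y' + D y' x'" "D p' y' \<le> D p' x' + D x' y'"
    "D q' r' \<le> D q' x' + D x' r'" "D x' r' \<le> D x' y' + D y' r'"
    using D(2) H by blast+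
  moreover have "D y' x' = D x' y'" "D q' x' = D x' q'"
    using D(1) by auto
  ultimately show ?thesis
    using 1 2 x y qr unfolding s by linarith
qed

lemma geodesic_segment_point:
  assumes "geodesic_segment_joining N d e u v" "s \<in> {0..d u v}"
  shows "e s \<in> N" "d u (e s) = s" "d (e s) v = d u v - s"
proof -
  have s: "0 \<in> {0..d u v}" "d u v \<in> {0..d u v}"
    using assms(2) by auto
  show "e s \<in> N" "d u (e s) = s" "d (e s) v = d u v - s"
    using assms s unfolding geodesic_segment_joining_def isometric_embedding_on_def
    by (auto, smt (verit) atLeastAtMost_iff)+
qed

lemma geodesic_segment_start:
  "geodesic_segment_joining N d e u v \<Longrightarrow> d u v \<ge> 0 \<Longrightarrow> u \<in> e ` {0..d u v}"
  unfolding geodesic_segment_joining_def by (auto intro: rev_image_eqI[of 0])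

text \<open>Handles two sides meeting at \<open>u\<close>. Side \<open>e\<close> leaves
  \<open>u\<close> and \<open>f\<close> arrives there, as in the cyclic orientation of a geodesic
  triangle, so rotating the vertices covers all three corners.\<close>

lemma four_point_corner:
  assumes "Metric_space M d" "\<kappa> < 0" "four_point_on V d"
    and V: "u \<in> V" "v \<in> V" "w \<in> V" "e s \<in> V" "f t \<in> V"
    and e: "geodesic_segment_joining M d e u v" "s \<in> {0..d u v}"
    and f: "geodesic_segment_joining M d f w u" "t \<in> {0..d w u}"
    and H: "u' \<in> hyperboloid" "v' \<in> hyperboloid" "w' \<in> hyperboloid"
    and e': "geodesic_segment_joining hyperboloid (model_dist \<kappa>) e' u' v'"
    and f': "geodesic_segment_joining hyperboloid (model_dist \<kappa>) f' w' u'"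
    and eq: "model_dist \<kappa> u' v' = d u v" "model_dist \<kappa> v' w' = d v w" "model_dist \<kappa> w' u' = d w u"
  shows "d (e s) (f t) \<le> model_dist \<kappa> (e' s) (f' t)"
proof -
  have dc: "d x y = d y x" for x y
    using assms(1) by (rule Metric_space.commute)
  have es: "d u (e s) = s" "d (e s) v = d u v - s"
    using geodesic_segment_point[OF e] by auto
  have ft: "d u (f t) = d u w - t" "d (f t) w = t"
    using geodesic_segment_point[OF f] dc by auto
  have es': "e' s \<in> hyperboloid" "model_dist \<kappa> u' (e' s) = s" "model_dist \<kappa> (e' s) v' = d u v - s"
    using geodesic_segment_point[OF e', of s] e(2) eq by auto
  have ft': "f' t \<in> hyperboloid" "model_dist \<kappa> u' (f' t) = d u w - t" "model_dist \<kappa> (f' t) w' = t"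
    using geodesic_segment_point[OF f', of t] f(2) eq dc[of u w]
    by (auto simp: model_dist_commute)
  show ?thesis
  proof (rule four_point_comparison[where d = d and V = V and p = u and q = v and r = w
        and D = "model_dist \<kappa>" and H = hyperboloid and p' = u' and q' = v' and r' = w'])
    show "d u (e s) + d (e s) v = d u v" "d u (f t) + d (f t) w = d u w"
      using es ft by auto
    show "model_dist \<kappa> u' (e' s) = d u (e s)" "model_dist \<kappa> (e' s) v' = d (e s) v"
      "model_dist \<kappa> u' (f' t) = d u (f t)" "model_dist \<kappa> (f' t) w' = d (f t) w"
      using es es' ft ft' by simp_all
    show "model_dist \<kappa> x z \<le> model_dist \<kappa> x y + model_dist \<kappa> y z"
      if "x \<in> hyperboloid" "y \<in> hyperboloid" "z \<in> hyperboloid" for x y z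
      using model_dist_triangle[OF assms(2) that] .
  qed (rule dc model_dist_commute | fact assms(3) V H es'(1) ft'(1) eq)+
qed

text \<open>Of the nine ordered pairs of sides, three are a side with itself, where both distances
  equal \<bar>\<open>s - t\<close>\<bar>; three are corners, and three follow from these by
  symmetry.\<close>

lemma four_point_imp_CAT_inequality:
  assumes "Metric_space M d" "\<kappa> < 0" and V: "four_point_on V d"
    and T: "geodesic_triangle M d p q r a b c"
    and sub: "a ` {0..d p q} \<union> b ` {0..d q r} \<union> c ` {0..d r p} \<subseteq> V"
  shows "CAT_inequality \<kappa> d p q r a b c"
proof -
  have T: "p \<in> M" "q \<in> M" "r \<in> M" "geodesic_segment_joining M d a p q"
    "geodesic_segment_joining M d b q r" "geodesic_segment_joining M d c r p"
    using T unfolding geodesic_triangle_def by auto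
  have img: "\<And>s. s \<in> {0..d p q} \<Longrightarrow> a s \<in> V" "\<And>s. s \<in> {0..d q r} \<Longrightarrow> b s \<in> V"
    "\<And>s. s \<in> {0..d r p} \<Longrightarrow> c s \<in> V"
    using sub by auto
  have dc: "d u v = d v u" for u v
    using assms(1) by (rule Metric_space.commute)
  have nonneg: "d u v \<ge> 0" for u v
    using assms(1) by (rule Metric_space.nonneg)
  have pqr: "p \<in> V" "q \<in> V" "r \<in> V"
    using T sub geodesic_segment_start[of M d a p q, OF _ nonneg]
      geodesic_segment_start[of M d b q r, OF _ nonneg]
      geodesic_segment_start[of M d c r p, OF _ nonneg] by auto
  show ?thesis
    unfolding CAT_inequality_def
  proof (intro allI impI)
    fix p' q' r' a' b' c'
    let ?D = "model_dist \<kappa>" and ?H = hyperboloid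
    assume "geodesic_triangle ?H ?D p' q' r' a' b' c'"
    then have T': "p' \<in> ?H" "q' \<in> ?H" "r' \<in> ?H" "geodesic_segment_joining ?H ?D a' p' q'"
      "geodesic_segment_joining ?H ?D b' q' r'" "geodesic_segment_joining ?H ?D c' r' p'"
      unfolding geodesic_triangle_def by auto
    assume eq: "?D p' q' = d p q" "?D q' r' = d q r" "?D r' p' = d r p"
    have same: "d (e s) (e t) \<le> ?D (e' s) (e' t)"
      if "geodesic_segment_joining M d e u v" "geodesic_segment_joining ?H ?D e' u' v'"
        "?D u' v' = d u v" "s \<in> {0..d u v}" "t \<in> {0..d u v}" for e e' u v u' v' s t
    proof -
      have "d (e s) (e t) = \<bar>s - t\<bar>"
        using that(1,4,5) unfolding geodesic_segment_joining_def isometric_embedding_on_def by blast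
      moreover have "?D (e' s) (e' t) = \<bar>s - t\<bar>"
        using that(2,4,5) unfolding geodesic_segment_joining_def isometric_embedding_on_def that(3)
        by blast
      ultimately show ?thesis by simp
    qed
    note corner = four_point_corner[OF assms(1,2) V]
    have ac: "d (a s) (c t) \<le> ?D (a' s) (c' t)" if "s \<in> {0..d p q}" "t \<in> {0..d r p}" for s t
      by (intro corner[of p q r a s c t p' q' r' a' c'] pqr img that T T' eq)
    have ba: "d (b s) (a t) \<le> ?D (b' s) (a' t)" if "s \<in> {0..d q r}" "t \<in> {0..d p q}" for s t
      by (intro corner[of q r p b s a t q' r' p' b' a'] pqr img that T T' eq)
    have cb: "d (c s) (b t) \<le> ?D (c' s) (b' t)" if "s \<in> {0..d r p}" "t \<in> {0..d q r}" for s t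
      by (intro corner[of r p q c s b t r' p' q' c' b'] pqr img that T T' eq)
    have ca: "d (c t) (a s) \<le> ?D (c' t) (a' s)" if "s \<in> {0..d p q}" "t \<in> {0..d r p}" for s t
      using ac[OF that] by (simp add: dc model_dist_commute)
    have ab: "d (a t) (b s) \<le> ?D (a' t) (b' s)" if "s \<in> {0..d q r}" "t \<in> {0..d p q}" for s t
      using ba[OF that] by (simp add: dc model_dist_commute)
    have bc: "d (b t) (c s) \<le> ?D (b' t) (c' s)" if "s \<in> {0..d r p}" "t \<in> {0..d q r}" for s t
      using cb[OF that] by (simp add: dc model_dist_commute)
    have aa: "d (a s) (a t) \<le> ?D (a' s) (a' t)" if "s \<in> {0..d p q}" "t \<in> {0..d p q}" for s t
      by (intro same[of a p q a' p' q'] that T T' eq)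
    have bb: "d (b s) (b t) \<le> ?D (b' s) (b' t)" if "s \<in> {0..d q r}" "t \<in> {0..d q r}" for s t
      by (intro same[of b q r b' q' r'] that T T' eq)
    have cc: "d (c s) (c t) \<le> ?D (c' s) (c' t)" if "s \<in> {0..d r p}" "t \<in> {0..d r p}" for s t
      by (intro same[of c r p c' r' p'] that T T' eq)
    show "\<forall>(e, e', l) \<in> {(a, a', d p q), (b, b', d q r), (c, c', d r p)}.
        \<forall>(f, f', m) \<in> {(a, a', d p q), (b, b', d q r), (c, c', d r p)}.
        \<forall>s\<in>{0..l}. \<forall>t\<in>{0..m}. d (e s) (f t) \<le> ?D (e' s) (f' t)"
      by (simp only: ball_simps prod.case)
        (blast intro: aa ab ac ba bb bc ca cb cc)
  qed
qed

section \<open>The figure eight\<close>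

text \<open>The two loops are \<open>{0..<1}\<close> and \<open>{-1<..0}\<close>; both ends of each loop are glued to \<open>0\<close>.\<close>

definition eight :: "real set" where
  "eight = {-1<..<1}"

text \<open>For \<open>\<bar>u\<bar> \<le> 1\<close> this is the distance from \<open>u\<close> to the nearest integer; the outer absolute
  value only matters outside that range, since \<open>Metric_space\<close> wants a distance that is
  nonnegative everywhere.\<close>

definition arc :: "real \<Rightarrow> real" where
  "arc u = min \<bar>u\<bar> \<bar>1 - \<bar>u\<bar>\<bar>"

text \<open>The length metric of the wedge of two circles: the shorter arc within a loop, otherwise
  the way through the vertex \<open>0\<close>, which counts as a point of both loops.\<close>

definition eight_dist :: "real \<Rightarrow> real \<Rightarrow> real" where
  "eight_dist x y =
     (if 0 \<le> x \<and> 0 \<le> y \<or> x \<le> 0 \<and> y \<le> 0 then arc (x - y) else arc x + arc y)"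

lemma arc_minus: "arc (- u) = arc u" "arc (u - v) = arc (v - u)"
  by (auto simp: arc_def abs_minus_commute)

lemma arc_nonneg: "arc u \<ge> 0"
  by (auto simp: arc_def)

lemma arc_eq_0_iff: "\<bar>u\<bar> < 1 \<Longrightarrow> arc u = 0 \<longleftrightarrow> u = 0"
  by (auto simp: arc_def min_def)

lemma arc_triangle:
  "\<bar>u\<bar> \<le> 1 \<Longrightarrow> \<bar>v\<bar> \<le> 1 \<Longrightarrow> \<bar>u + v\<bar> \<le> 1 \<Longrightarrow> arc (u + v) \<le> arc u + arc v"
  unfolding arc_def by (smt (verit))

lemma eight_dist_commute: "eight_dist x y = eight_dist y x"
  using arc_minus(2)[of x y] by (auto simp: eight_dist_def)

lemma eight_dist_0: "eight_dist 0 y = arc y"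
  by (cases "0 \<le> y") (auto simp: eight_dist_def arc_minus(1))

lemma Metric_space_eight: "Metric_space eight eight_dist"
proof
  show "0 \<le> eight_dist x y" for x y
    by (simp add: eight_dist_def arc_nonneg)
  show "eight_dist x y = eight_dist y x" for x y
    by (rule eight_dist_commute)
  show "eight_dist x y = 0 \<longleftrightarrow> x = y" if "x \<in> eight" "y \<in> eight" for x y
    using that arc_eq_0_iff[of x] arc_eq_0_iff[of y] arc_eq_0_iff[of "x - y"]
      arc_nonneg[of x] arc_nonneg[of y]
    unfolding eight_dist_def eight_def by auto
  show "eight_dist x z \<le> eight_dist x y + eight_dist y z"
    if "x \<in> eight" "y \<in> eight" "z \<in> eight" for x y z
  proof -
    \<comment> \<open>The four facts correspond to all points in one loop, and to \<open>y\<close>,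
      \<open>z\<close> or \<open>x\<close> alone in the other loop, in this order.\<close>
    have "arc (x - z) \<le> arc (x - y) + arc (y - z)" if "\<bar>x - y\<bar> \<le> 1" "\<bar>y - z\<bar> \<le> 1" "\<bar>x - z\<bar> \<le> 1"
      using arc_triangle[of "x - y" "y - z"] that by simp
    moreover have "arc (x - z) \<le> arc x + arc z" if "\<bar>x - z\<bar> \<le> 1"
      using arc_triangle[of x "- z"] that \<open>x \<in> eight\<close> \<open>z \<in> eight\<close>
      by (auto simp: arc_minus eight_def)
    moreover have "arc x \<le> arc (x - y) + arc y" if "\<bar>x - y\<bar> \<le> 1"
      using arc_triangle[of "x - y" y] that \<open>x \<in> eight\<close> \<open>y \<in> eight\<close> by (auto simp: eight_def)
    moreover have "arc z \<le> arc y + arc (y - z)" if "\<bar>y - z\<bar> \<le> 1"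
      using arc_triangle[of "z - y" y] that \<open>z \<in> eight\<close> \<open>y \<in> eight\<close> arc_minus(2)[of y z]
      by (auto simp: eight_def abs_minus_commute add.commute)
    ultimately show ?thesis
      using that arc_nonneg[of y] arc_nonneg[of "x - y"] arc_nonneg[of "y - z"]
        arc_minus(1)[of z] arc_eq_0_iff[of 0]
      unfolding eight_dist_def eight_def greaterThanLessThan_iff by (smt (verit))
  qed
qed

section \<open>Local tree structure and the curvature bound\<close>

lemma four_point_on_real: "four_point_on A (\<lambda>x y. \<bar>x - y\<bar>)"
  unfolding four_point_on_def by (smt (verit))

text \<open>Four points of a star are given by arm labels \<open>a, b, c, d\<close> and distances
  \<open>i, j, k, l\<close> from the centre. At the centre the label does not affect the distance
  formula.\<close>

lemma four_point_star:
  fixes i j k l :: real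
  assumes "i \<ge> 0" "j \<ge> 0" "k \<ge> 0" "l \<ge> 0"
  shows "(if a = b then \<bar>i - j\<bar> else i + j) + (if c = d then \<bar>k - l\<bar> else k + l)
    \<le> max ((if a = c then \<bar>i - k\<bar> else i + k) + (if b = d then \<bar>j - l\<bar> else j + l))
        ((if a = d then \<bar>i - l\<bar> else i + l) + (if b = c then \<bar>j - k\<bar> else j + k))"
  using assms by (smt (verit))

text \<open>The ball at the vertex is a star with four arms, and the others are intervals.\<close>

lemma four_point_on_mball_eight:
  assumes "x \<in> eight"
  shows "\<exists>r>0. four_point_on (Metric_space.mball eight eight_dist x r) eight_dist"
proof (cases "x = 0")
  case True
  \<comment> \<open>The sign selects the loop and the second component the end of it. Within radius
    1/4, the shorter arc between opposite ends of a loop runs through the vertex.\<close>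
  define arm :: "real \<Rightarrow> bool \<times> bool" where "arm y = (y > 0, \<bar>y\<bar> < 1/2)" for y
  have ball: "y \<in> eight \<and> arc y < 1/4" if "y \<in> Metric_space.mball eight eight_dist x (1/4)" for y
    using that True
    by (auto simp: Metric_space.in_mball[OF Metric_space_eight] eight_dist_0)
  have arc: "\<bar>u\<bar> < 1/4 \<and> arc u = \<bar>u\<bar> \<or> 3/4 < \<bar>u\<bar> \<and> arc u = 1 - \<bar>u\<bar>"
    if "u \<in> eight" "arc u < 1/4" for u
    using that unfolding eight_def arc_def by (auto simp: min_def split: if_splits)
  have dist: "eight_dist y z = (if arm y = arm z then \<bar>arc y - arc z\<bar> else arc y + arc z)"
    if "y \<in> eight" "arc y < 1/4" "z \<in> eight" "arc z < 1/4" for y z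
    using that(1,3) arc[OF that(1,2)] arc[OF that(3,4)]
    unfolding eight_dist_def arm_def eight_def arc_def[of "y - z"] prod.inject
    by (auto simp: abs_if min_def)
  have "four_point_on (Metric_space.mball eight eight_dist x (1/4)) eight_dist"
    unfolding four_point_on_def
  proof (intro ballI)
    fix y z u v
    assume "y \<in> Metric_space.mball eight eight_dist x (1/4)"
      "z \<in> Metric_space.mball eight eight_dist x (1/4)"
      "u \<in> Metric_space.mball eight eight_dist x (1/4)"
      "v \<in> Metric_space.mball eight eight_dist x (1/4)"
    note b = this[THEN ball]
    show "eight_dist y z + eight_dist u v
        \<le> max (eight_dist y u + eight_dist z v) (eight_dist y v + eight_dist z u)"
      using b by (simp only: dist four_point_star arc_nonneg)
  qed
  then show ?thesis
    by (intro exI[of _ "1/4"]) simp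
next
  case False
  \<comment> \<open>The bound \<open>arc x\<close> keeps the ball off the vertex; the bound 1/4
    keeps its points less than 1/2 apart, where \<open>arc\<close> is the absolute value.\<close>
  define r where "r = min (arc x) (1/4)"
  have ball: "y \<in> eight \<and> \<bar>x - y\<bar> < 1/4 \<and> x * y > 0" if "y \<in> Metric_space.mball eight eight_dist x r" for y
  proof -
    have y: "y \<in> eight" "eight_dist x y < r"
      using that by (auto simp: Metric_space.in_mball[OF Metric_space_eight])
    have "\<bar>x - y\<bar> < 1/4 \<and> (x > 0 \<and> y > 0 \<or> x < 0 \<and> y < 0)"
      using y assms unfolding r_def eight_dist_def arc_def eight_def
      by (auto simp: min_def abs_if split: if_splits)
    with y show ?thesis
      by (auto simp: zero_less_mult_iff)
  qed
  have "eight_dist y z = \<bar>y - z\<bar>"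
    if "y \<in> Metric_space.mball eight eight_dist x r" "z \<in> Metric_space.mball eight eight_dist x r" for y z
  proof -
    have "\<bar>y - z\<bar> < 1/2"
      using ball[OF that(1)] ball[OF that(2)] by linarith
    then have "arc (y - z) = \<bar>y - z\<bar>"
      unfolding arc_def by linarith
    moreover have "y > 0 \<and> z > 0 \<or> y < 0 \<and> z < 0"
      using ball[OF that(1)] ball[OF that(2)] by (auto simp: zero_less_mult_iff)
    ultimately show ?thesis
      by (auto simp: eight_dist_def)
  qed
  then have "four_point_on (Metric_space.mball eight eight_dist x r) eight_dist"
    using four_point_on_real unfolding four_point_on_def by (metis UNIV_I)
  moreover have "r > 0"
    using False assms by (auto simp: r_def arc_def eight_def)
  ultimately show ?thesis
    by blast
qed

lemma curvature_le_eight: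
  assumes "\<kappa> < 0"
  shows "curvature_le eight eight_dist \<kappa>"
  unfolding curvature_le_def
proof (intro ballI)
  interpret Metric_space eight eight_dist by (rule Metric_space_eight)
  fix x assume x: "x \<in> eight"
  then obtain r where "r > 0" "four_point_on (mball x r) eight_dist"
    using four_point_on_mball_eight by blast
  then show "\<exists>V U. openin mtopology U \<and> x \<in> U \<and> U \<subseteq> V \<and> V \<subseteq> eight \<and>
      (\<forall>p q r a b c. geodesic_triangle eight eight_dist p q r a b c \<longrightarrow>
        a ` {0..eight_dist p q} \<union> b ` {0..eight_dist q r} \<union> c ` {0..eight_dist r p} \<subseteq> V \<longrightarrow>
        CAT_inequality \<kappa> eight_dist p q r a b c)"
    using x
    by (intro exI[of _ "mball x r"] conjI allI impI mball_subset_mspace openin_mball order_refl)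
      (auto intro!: four_point_imp_CAT_inequality[OF Metric_space_axioms assms, where V = "mball x r"])
qed

section \<open>Geodesics in the figure eight\<close>

text \<open>The word \<open>w\<close> takes the values \<open>\<plusminus>1\<close>, one for each loop.\<close>

definition word_path :: "(int \<Rightarrow> real) \<Rightarrow> real \<Rightarrow> real" where
  "word_path w t = w \<lfloor>t\<rfloor> * frac t"

lemma word_path_in_eight: "w \<lfloor>t\<rfloor> \<in> {1, -1} \<Longrightarrow> word_path w t \<in> eight"
  using frac_lt_1[of t] less_le_trans[OF _ frac_ge_0, of "-1" t]
  by (auto simp: word_path_def eight_def)

text \<open>A path without backtracking is shortest up to half the length of a loop. Parameters this
  close lie in the same letter or in consecutive letters.\<close>

lemma eight_dist_word_path:
  assumes w: "\<And>n. w n \<in> {1, -1}" and st: "\<bar>s - t\<bar> \<le> 1/2"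
  shows "eight_dist (word_path w s) (word_path w t) = \<bar>s - t\<bar>"
proof -
  have *: "eight_dist (word_path w s) (word_path w t) = t - s" if "s \<le> t" "t - s \<le> 1/2" for s t
  proof -
    define x y where "x = frac s" and "y = frac t"
    have s: "s = of_int \<lfloor>s\<rfloor> + x" "0 \<le> x" "x < 1" and t: "t = of_int \<lfloor>t\<rfloor> + y" "0 \<le> y" "y < 1"
      using frac_ge_0 frac_lt_1 by (auto simp: x_def y_def frac_def)
    have "\<lfloor>t\<rfloor> = \<lfloor>s\<rfloor> \<or> \<lfloor>t\<rfloor> = \<lfloor>s\<rfloor> + 1"
      using that by linarith
    then show ?thesis
    proof
      assume 1: "\<lfloor>t\<rfloor> = \<lfloor>s\<rfloor>"
      then have "t - s = y - x"
        using s t by linarith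
      then show ?thesis
        using 1 w[of "\<lfloor>s\<rfloor>"] s t that unfolding word_path_def x_def[symmetric] y_def[symmetric]
        by (auto simp: eight_dist_def arc_def)
    next
      \<comment> \<open>The path crosses the vertex. Equal letters give one arc through the glued
        ends, different letters a sum of two arcs; both have length
        \<open>1 + y - x\<close>.\<close>
      assume 2: "\<lfloor>t\<rfloor> = \<lfloor>s\<rfloor> + 1"
      then have "t - s = 1 + y - x"
        using s t by linarith
      then show ?thesis
        using w[of "\<lfloor>s\<rfloor>"] w[of "\<lfloor>t\<rfloor>"] s(2,3) t(2,3) that
        unfolding word_path_def x_def[symmetric] y_def[symmetric]
        by (auto simp: eight_dist_def arc_def)
    qed
  qed
  show ?thesis
    using *[of s t] *[of t s] st by (cases "s \<le> t") (auto simp: eight_dist_commute)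
qed

lemma geodesic_line_word_path:
  assumes "\<And>n. w n \<in> {1, -1}"
  shows "geodesic_line eight eight_dist (word_path w)"
proof -
  have "isometric_embedding_on eight eight_dist {t - 1/4..t + 1/4} (word_path w)" for t
    unfolding isometric_embedding_on_def
  proof (intro conjI ballI)
    show "word_path w ` {t - 1/4..t + 1/4} \<subseteq> eight"
      using word_path_in_eight[of w, OF assms] by auto
    show "eight_dist (word_path w u) (word_path w v) = \<bar>u - v\<bar>"
      if "u \<in> {t - 1/4..t + 1/4}" "v \<in> {t - 1/4..t + 1/4}" for u v
      using that by (intro eight_dist_word_path[of w, OF assms])
        (simp only: atLeastAtMost_iff, linarith)
  qed
  then show ?thesis
    unfolding local_geodesic_on_def by (auto intro: exI[of _ "1/4"])
qed

text \<open>An upper bound on the least period is enough, since approximation is only tested on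
  \<open>{0..period c}\<close>.\<close>

lemma closed_geodesic_word_path:
  assumes "\<And>n. w n \<in> {1, -1}" "p > 0" "\<And>n. w (n + int p) = w n"
  shows "closed_geodesic eight eight_dist (word_path w)" "period (word_path w) \<le> real p"
proof -
  have per: "word_path w (t + real p) = word_path w t" for t
  proof -
    have "\<lfloor>t + real p\<rfloor> = \<lfloor>t\<rfloor> + int p"
      by (metis floor_add_int of_int_of_nat_eq)
    then show ?thesis
      by (simp add: word_path_def frac_def assms(3))
  qed
  then show "closed_geodesic eight eight_dist (word_path w)"
    unfolding closed_geodesic_def using geodesic_line_word_path[OF assms(1)] assms(2)
    by (auto intro!: exI[of _ "real p"])
  show "period (word_path w) \<le> real p"
    unfolding period_def using per assms(2)
    by (intro cInf_lower) (auto intro: bdd_belowI[of _ 0])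
qed

section \<open>Compactness\<close>

text \<open>The alternating word traverses each loop once on \<open>{0..2}\<close>, so the space is
  a continuous image of a compact interval. Local compactness and completeness follow.\<close>

lemma compact_space_eight: "compact_space (Metric_space.mtopology eight eight_dist)"
proof -
  interpret Metric_space eight eight_dist by (rule Metric_space_eight)
  define w :: "int \<Rightarrow> real" where "w n = (if even n then 1 else -1)" for n
  have w: "w n \<in> {1, -1}" for n
    by (simp add: w_def)
  have "continuous_map (top_of_set {0..2}) mtopology (word_path w)"
    unfolding continuous_map_to_metric
  proof (intro ballI allI impI)
    fix x \<epsilon> :: real
    assume "x \<in> topspace (top_of_set {0..2})" "\<epsilon> > 0"
    then show "\<exists>U. openin (top_of_set {0..2}) U \<and> x \<in> U \<and>
        (\<forall>y\<in>U. word_path w y \<in> mball (word_path w x) \<epsilon>)"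
      using word_path_in_eight[of w, OF w] eight_dist_word_path[of w, OF w]
      by (intro exI[of _ "{0..2} \<inter> ball x (min \<epsilon> (1/2))"])
        (auto simp: openin_open_Int dist_real_def)
  qed
  then have "compactin mtopology (word_path w ` {0..2})"
    by (rule image_compactin[rotated]) (simp add: compactin_subtopology)
  moreover have "word_path w ` {0..2} = eight"
  proof (intro equalityI subsetI)
    fix x assume x: "x \<in> eight"
    show "x \<in> word_path w ` {0..2}"
    proof (cases "x \<ge> 0")
      case True
      then have "\<lfloor>x\<rfloor> = 0"
        using x by (simp add: eight_def floor_eq_iff)
      then show ?thesis
        using True x by (intro image_eqI[of _ _ x]) (auto simp: eight_def word_path_def w_def frac_def)
    next
      case False
      then have "\<lfloor>1 - x\<rfloor> = 1"
        using x by (simp add: eight_def floor_eq_iff)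
      then show ?thesis
        using False x
        by (intro image_eqI[of _ _ "1 - x"]) (simp_all add: eight_def word_path_def w_def frac_def)
    qed
  qed (use word_path_in_eight[of w, OF w] in auto)
  ultimately show ?thesis
    by (simp add: compact_space_def)
qed

section \<open>Geodesic segments between arbitrary points\<close>

lemma geodesic_segment_joining_reverse:
  assumes "geodesic_segment_joining M d c p q" "d q p = d p q" "d p q \<ge> 0"
  shows "geodesic_segment_joining M d (\<lambda>u. c (d p q - u)) q p"
  using assms unfolding geodesic_segment_joining_def isometric_embedding_on_def
  by (auto simp: image_subset_iff)

lemma geodesic_segment_word_path:
  assumes w: "\<And>n. w n \<in> {1, -1}" and st: "\<bar>s - t\<bar> \<le> 1/2"
    and p: "p = word_path w s" and q: "q = word_path w t"
  shows "\<exists>c. geodesic_segment_joining eight eight_dist c p q"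
proof -
  define e :: real where "e = (if s \<le> t then 1 else -1)"
  have d: "eight_dist p q = \<bar>s - t\<bar>"
    unfolding p q by (rule eight_dist_word_path[of w, OF w st])
  have "eight_dist (word_path w (s + e * u)) (word_path w (s + e * v)) = \<bar>u - v\<bar>"
    if "u \<in> {0..\<bar>s - t\<bar>}" "v \<in> {0..\<bar>s - t\<bar>}" for u v
  proof -
    have "\<bar>(s + e * u) - (s + e * v)\<bar> = \<bar>u - v\<bar>"
      by (auto simp: e_def)
    moreover have "\<bar>u - v\<bar> \<le> 1/2"
      using that st by (simp only: atLeastAtMost_iff) linarith
    ultimately show ?thesis
      using eight_dist_word_path[of w "s + e * u" "s + e * v", OF w] by simp
  qed
  moreover have "s + e * \<bar>s - t\<bar> = t"
    by (auto simp: e_def)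
  ultimately have "geodesic_segment_joining eight eight_dist (\<lambda>u. word_path w (s + e * u)) p q"
    using word_path_in_eight[of w, OF w]
    unfolding geodesic_segment_joining_def isometric_embedding_on_def d by (auto simp: p q)
  then show ?thesis
    by blast
qed

lemma word_path_const:
  assumes "0 \<le> x" "x < 1"
  shows "word_path (\<lambda>_. a) x = a * x" "word_path (\<lambda>_. a) (x + 1) = a * x"
    "word_path (\<lambda>_. a) (x - 1) = a * x"
proof -
  have "frac x = x"
    using assms by (simp add: frac_eq)
  moreover have "frac (x + 1) = frac x" "frac (x - 1) = frac x"
    using frac_1_eq[of x] frac_1_eq[of "x - 1"] by auto
  ultimately show "word_path (\<lambda>_. a) x = a * x" "word_path (\<lambda>_. a) (x + 1) = a * x"
    "word_path (\<lambda>_. a) (x - 1) = a * x"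
    by (simp_all add: word_path_def)
qed

lemma geodesic_segment_same_loop:
  assumes a: "a = 1 \<or> a = -1" and x: "0 \<le> x" "x < 1" and y: "0 \<le> y" "y < 1"
  shows "\<exists>c. geodesic_segment_joining eight eight_dist c (a * x) (a * y)"
proof -
  \<comment> \<open>If the points are more than 1/2 apart, the smaller parameter is advanced by a
    full turn, so that the path follows the shorter arc.\<close>
  define s t where "s = (if x + 1/2 < y then x + 1 else x)" and "t = (if y + 1/2 < x then y + 1 else y)"
  have "\<bar>s - t\<bar> \<le> 1/2"
    using x y unfolding s_def t_def by (simp add: abs_if)
  moreover have "word_path (\<lambda>_. a) s = a * x" "word_path (\<lambda>_. a) t = a * y"
    using word_path_const[OF x] word_path_const[OF y] by (auto simp: s_def t_def)
  ultimately show ?thesis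
    using geodesic_segment_word_path[of "\<lambda>_. a" s t] a by auto
qed

lemma eight_dist_opposite:
  assumes "0 \<le> x" "y \<le> 0"
  shows "eight_dist x y = arc x + arc y"
  using assms arc_minus(1)[of y] by (auto simp: eight_dist_def arc_def)

text \<open>Parameters in \<open>{-1/2..1/2}\<close> on a constant word are signed distances from
  the vertex.\<close>

lemma eight_dist_word_path_opposite:
  assumes "\<bar>s\<bar> \<le> 1/2" "\<bar>t\<bar> \<le> 1/2"
  shows "eight_dist (word_path (\<lambda>_. 1) s) (word_path (\<lambda>_. -1) t) = \<bar>s\<bar> + \<bar>t\<bar>"
proof -
  have "arc (frac u) = \<bar>u\<bar>" if "\<bar>u\<bar> \<le> 1/2" for u
  proof (cases "u \<ge> 0")
    case True
    then show ?thesis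
      using that by (simp add: frac_eq arc_def)
  next
    case False
    then have "frac u = u + 1"
      using that by (simp add: frac_unique_iff)
    then show ?thesis
      using False that by (simp add: arc_def)
  qed
  then show ?thesis
    using assms by (simp add: word_path_def eight_dist_opposite arc_minus(1))
qed

lemma geodesic_segment_opposite_loops:
  assumes x: "0 \<le> x" "x < 1" and y: "0 \<le> y" "y < 1"
  shows "\<exists>c. geodesic_segment_joining eight eight_dist c x (- y)"
proof -
  let ?A = "word_path (\<lambda>_. 1)" and ?B = "word_path (\<lambda>_. -1)"
  define s t where "s = (if x \<le> 1/2 then x else x - 1)" and "t = (if y \<le> 1/2 then y else y - 1)"
  define e f :: real where "e = (if s \<ge> 0 then 1 else -1)" and "f = (if t \<ge> 0 then 1 else -1)"
  have st: "\<bar>s\<bar> \<le> 1/2" "\<bar>t\<bar> \<le> 1/2"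
    using x y by (auto simp: s_def t_def)
  have A: "?A s = x" and B: "?B t = - y"
    using word_path_const[OF x] word_path_const[OF y] by (auto simp: s_def t_def)
  have d: "eight_dist x (- y) = \<bar>s\<bar> + \<bar>t\<bar>"
    using eight_dist_word_path_opposite[OF st] by (simp add: A B)
  \<comment> \<open>The path reaches the vertex at time \<bar>\<open>s\<close>\<bar> and then enters
    the other loop; \<open>e\<close> and \<open>f\<close> select the shorter side of each
    loop.\<close>
  define c where "c u = (if u \<le> \<bar>s\<bar> then ?A (s - e * u) else ?B (f * (u - \<bar>s\<bar>)))" for u
  have iso: "eight_dist (c u) (c v) = v - u" if "0 \<le> u" "u \<le> v" "v \<le> \<bar>s\<bar> + \<bar>t\<bar>" for u v
  proof -
    consider "v \<le> \<bar>s\<bar>" | "u \<le> \<bar>s\<bar>" "\<bar>s\<bar> < v" | "\<bar>s\<bar> < u"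
      by linarith
    then show ?thesis
    proof cases
      case 1
      then show ?thesis
        using that st eight_dist_word_path[of "\<lambda>_. 1" "s - e * u" "s - e * v"]
        by (auto simp: c_def e_def split: if_splits)
    next
      case 2
      then have "\<bar>s - e * u\<bar> = \<bar>s\<bar> - u" "\<bar>f * (v - \<bar>s\<bar>)\<bar> = v - \<bar>s\<bar>"
        using that by (auto simp: e_def f_def)
      then show ?thesis
        using 2 that st eight_dist_word_path_opposite[of "s - e * u" "f * (v - \<bar>s\<bar>)"]
        by (simp add: c_def)
    next
      case 3
      then show ?thesis
        using that st eight_dist_word_path[of "\<lambda>_. -1" "f * (u - \<bar>s\<bar>)" "f * (v - \<bar>s\<bar>)"]
        by (auto simp: c_def f_def split: if_splits)
    qed
  qed
  have "eight_dist (c u) (c v) = \<bar>u - v\<bar>"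
    if "u \<in> {0..\<bar>s\<bar> + \<bar>t\<bar>}" "v \<in> {0..\<bar>s\<bar> + \<bar>t\<bar>}" for u v
    using iso[of u v] iso[of v u] that eight_dist_commute[of "c u" "c v"] by (cases "u \<le> v") auto
  moreover have "c u \<in> eight" for u
    by (simp add: c_def word_path_in_eight)
  moreover have "c 0 = x"
    by (simp add: c_def A)
  moreover have "c (\<bar>s\<bar> + \<bar>t\<bar>) = - y"
  \<comment> \<open>For \<open>t = 0\<close> the final time still falls in the first branch of
    \<open>c\<close>.\<close>
  proof (cases "t = 0")
    case True
    have "s - e * \<bar>s\<bar> = 0"
      by (simp add: e_def)
    with True B show ?thesis
      by (simp add: c_def word_path_def)
  next
    case False
    have "f * \<bar>t\<bar> = t"
      by (simp add: f_def)
    with False B show ?thesis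
      by (simp add: c_def)
  qed
  ultimately have "geodesic_segment_joining eight eight_dist c x (- y)"
    unfolding geodesic_segment_joining_def isometric_embedding_on_def d by auto
  then show ?thesis
    by blast
qed

lemma geodesic_space_eight: "geodesic_space eight eight_dist"
  unfolding geodesic_space_def
proof (intro ballI)
  fix p q assume pq: "p \<in> eight" "q \<in> eight"
  consider "p \<ge> 0" "q \<ge> 0" | "p \<le> 0" "q \<le> 0" | "p \<ge> 0" "q \<le> 0" | "p \<le> 0" "q \<ge> 0"
    by linarith
  then show "\<exists>c. geodesic_segment_joining eight eight_dist c p q"
  proof cases
    case 1
    then show ?thesis
      using geodesic_segment_same_loop[of 1 p q] pq by (simp add: eight_def)
  next
    case 2
    then show ?thesis
      using geodesic_segment_same_loop[of "-1" "- p" "- q"] pq by (simp add: eight_def)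
  next
    case 3
    then show ?thesis
      using geodesic_segment_opposite_loops[of p "- q"] pq by (simp add: eight_def)
  next
    case 4
    then obtain c where "geodesic_segment_joining eight eight_dist c q p"
      using geodesic_segment_opposite_loops[of q "- p"] pq by (auto simp: eight_def)
    then show ?thesis
      using geodesic_segment_joining_reverse[of eight eight_dist c q p] eight_dist_commute[of p q]
        Metric_space.nonneg[OF Metric_space_eight] by blast
  qed
qed

section \<open>A geodesic that is approximated by closed geodesics but not recurrent\<close>

definition ab_word :: "int \<Rightarrow> real" where
  "ab_word n = (if even n then 1 else -1)"

definition gamma_word :: "int \<Rightarrow> real" where
  "gamma_word n = (if n < 0 then 1 else ab_word n)"

text \<open>The closed geodesic agrees exactly with the given one over a period, with
  \<open>ty = tx\<close>, so it serves every positive error: the constant word for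
  \<open>tx < 0\<close>, the alternating word otherwise.\<close>

lemma approximated_word_path_gamma:
  "approximated_by_closed_geodesics eight eight_dist (word_path gamma_word)"
proof -
  have self: "eight_dist x x = 0" for x
    by (simp add: eight_dist_def arc_def)
  have one: "closed_geodesic eight eight_dist (word_path (\<lambda>_. 1))" "period (word_path (\<lambda>_. 1)) \<le> 1"
    using closed_geodesic_word_path[of "\<lambda>_. 1" 1] by auto
  have ab: "closed_geodesic eight eight_dist (word_path ab_word)"
    by (rule closed_geodesic_word_path[of ab_word 2]) (auto simp: ab_word_def)
  have "\<exists>c. closed_geodesic eight eight_dist c \<and> (\<forall>t\<in>{0..period c}. c (t + tx) = word_path gamma_word (t + tx))"
    for tx
  proof (cases "tx < 0")
    case True
    have "word_path (\<lambda>_. 1) (t + tx) = word_path gamma_word (t + tx)"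
      if "t \<in> {0..period (word_path (\<lambda>_. 1))}" for t
    proof -
      \<comment> \<open>One period may run into letter 0, which is still 1.\<close>
      have "\<lfloor>t + tx\<rfloor> < 0 \<or> \<lfloor>t + tx\<rfloor> = 0"
        using that one(2) True by (simp only: atLeastAtMost_iff) linarith
      then have "gamma_word \<lfloor>t + tx\<rfloor> = 1"
        by (auto simp: gamma_word_def ab_word_def)
      then show ?thesis
        by (simp add: word_path_def)
    qed
    with one(1) show ?thesis
      by blast
  next
    case False
    then have "word_path ab_word (t + tx) = word_path gamma_word (t + tx)" if "t \<ge> 0" for t
      using that by (simp add: word_path_def gamma_word_def)
    with ab show ?thesis
      by (intro exI[of _ "word_path ab_word"]) auto
  qed
  then show ?thesis
    unfolding approximated_by_closed_geodesics_def using self by (metis rangeI)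
qed

text \<open>At -1/2 and 1/2 the geodesic is at the midpoint of the positive loop. Recurrence would
  bring it near that midpoint at two late times one unit apart, hence in adjacent letters, which
  alternate.\<close>

lemma not_recurrent_word_path_gamma: "\<not> recurrent eight_dist (word_path gamma_word)"
proof
  let ?\<gamma> = "word_path gamma_word"
  assume "recurrent eight_dist ?\<gamma>"
  then obtain t :: "nat \<Rightarrow> real" where t: "filterlim t at_top sequentially"
    and conv: "\<And>K \<epsilon>. compact K \<Longrightarrow> \<epsilon> > 0 \<Longrightarrow>
      \<forall>\<^sub>F n in sequentially. \<forall>s\<in>K. eight_dist (geodesic_shift (t n) ?\<gamma> s) (?\<gamma> s) < \<epsilon>"
    unfolding recurrent_def by blast
  \<comment> \<open>This puts both shifted times, \<open>t n - 1/2\<close> and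
    \<open>t n + 1/2\<close>, into the alternating half of the word.\<close>
  have "\<forall>\<^sub>F n in sequentially. t n \<ge> 1/2"
    using t unfolding filterlim_at_top by blast
  moreover have "\<forall>\<^sub>F n in sequentially. \<forall>s\<in>{-1/2, 1/2}.
      eight_dist (geodesic_shift (t n) ?\<gamma> s) (?\<gamma> s) < 1/2"
    by (rule conv) auto
  ultimately have "\<forall>\<^sub>F n in sequentially. t n \<ge> 1/2 \<and> (\<forall>s\<in>{-1/2, 1/2}.
      eight_dist (geodesic_shift (t n) ?\<gamma> s) (?\<gamma> s) < 1/2)"
    by (rule eventually_conj)
  then obtain n where n: "t n \<ge> 1/2"
    "\<forall>s\<in>{-1/2, 1/2}. eight_dist (geodesic_shift (t n) ?\<gamma> s) (?\<gamma> s) < 1/2"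
    by (auto dest: eventually_happens)
  define u where "u = t n - 1/2"
  have half: "?\<gamma> (- (1/2)) = 1/2" "?\<gamma> (1/2) = 1/2"
    by (simp_all add: word_path_def gamma_word_def ab_word_def frac_def floor_eq_iff)
  have near: "eight_dist (?\<gamma> u) (1/2) < 1/2" "eight_dist (?\<gamma> (u + 1)) (1/2) < 1/2"
    using n(2) by (simp_all add: half u_def geodesic_shift_def add.commute)
  have even: "even \<lfloor>v\<rfloor>" if "v \<ge> 0" "eight_dist (?\<gamma> v) (1/2) < 1/2" for v
  proof (rule ccontr)
    assume "odd \<lfloor>v\<rfloor>"
    then have "?\<gamma> v = - frac v"
      using that by (simp add: word_path_def gamma_word_def ab_word_def)
    \<comment> \<open>From the negative loop the midpoint is reached only through the vertex, at
      distance at least 1/2.\<close>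
    then have "eight_dist (?\<gamma> v) (1/2) = 1/2 + arc (frac v)"
      using eight_dist_opposite[of "1/2" "- frac v"] eight_dist_commute
      by (simp add: arc_minus(1)) (simp add: arc_def)
    with that(2) arc_nonneg[of "frac v"] show False
      by simp
  qed
  have "u \<ge> 0"
    using n(1) by (simp add: u_def)
  then show False
    using even[OF _ near(1)] even[OF _ near(2)] by simp
qed

theorem mainTheorem2:
  shows "\<exists>(\<kappa>::real) (M::real set) (d::real \<Rightarrow> real \<Rightarrow> real) (\<gamma>::real \<Rightarrow> real).
    \<kappa> < 0 \<and>
    Metric_space M d \<and>
    locally_compact_space (Metric_space.mtopology M d) \<and>
    Metric_space.mcomplete M d \<and>
    geodesic_space M d \<and>
    curvature_le M d \<kappa> \<and>
    geodesic_line M d \<gamma> \<and>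
    approximated_by_closed_geodesics M d \<gamma> \<and>
    \<not> recurrent d \<gamma>"
proof (intro exI conjI)
  show "(-1::real) < 0"
    by simp
  show "Metric_space eight eight_dist"
    by (rule Metric_space_eight)
  show "locally_compact_space (Metric_space.mtopology eight eight_dist)"
    by (rule compact_imp_locally_compact_space[OF compact_space_eight])
  show "Metric_space.mcomplete eight eight_dist"
    by (rule Metric_space.compact_space_imp_mcomplete[OF Metric_space_eight compact_space_eight])
  show "geodesic_space eight eight_dist"
    by (rule geodesic_space_eight)
  show "curvature_le eight eight_dist (-1)"
    by (rule curvature_le_eight) simp
  show "geodesic_line eight eight_dist (word_path gamma_word)"
    by (rule geodesic_line_word_path) (simp add: gamma_word_def ab_word_def)
  show "approximated_by_closed_geodesics eight eight_dist (word_path gamma_word)"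
    by (rule approximated_word_path_gamma)
  show "\<not> recurrent eight_dist (word_path gamma_word)"
    by (rule not_recurrent_word_path_gamma)
qed

end
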